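(* Let $\mathbf{x}\in\mathbb{R}^T$ be a time series with quantile state sequence $\mathbf{b}=(b_1,\dots,b_T)\in\{1,\dots,Q\}^T$, global transition matrix $W$ and global Markov Transition Field $M$, $M_{ij}=W_{b_i,b_j}$. Let $K\in\mathbb{N}$ with $K\mid T$, let $W^{(1)},\dots,W^{(K)}$ be the local transition matrices, and let $\mathcal{M}$ be the Temporal Markov Transition Field, $\mathcal{M}_{ij}=W^{(\mathrm{chunk}(i))}_{b_i,b_j}$. If $W^{(1)}=\cdots=W^{(K)}=W$, then $\mathcal{M}_{ij}=M_{ij}$ for all $i,j\in\{1,\dots,T\}$.
   Context: Quantile states. Given $\mathbf{x}=(x_1,\dots,x_T)\in\mathbb{R}^T$ and a bin count $Q\in\mathbb{N}$, let $q_0<q_1<\cdots<q_Q$ be the empirical quantile boundaries of $\mathbf{x}$ such that each interval $[q_{k-1},q_k)$ contains $\lfloor T/Q\rfloor$ observations (with boundary adjustments for divisibility). The state of $x_t$ is $b_t=k$ if $x_t\in[q_{k-1},q_k)$, $k=1,\dots,Q$. The sequence $\mathbf{b}=(b_1,\dots,b_T)$ is the state sequence. Global transition matrix and global field. $W$ is the $Q\times Q$ matrix $$W_{kl}=\frac{\#\{t\in\{1,\dots,T-1\}: b_t=k \text{ and } b_{t+1}=l\}}{\#\{t\in\{1,\dots,T-1\}: b_t=k\}},\quad k,l\in\{1,\dots,Q\}.$$ The global Markov Transition Field is the $T\times T$ matrix $M$ with $M_{ij}=W_{b_i,b_j}$. Chunks. For $K\in\mathbb{N}$ with $K\mid T$,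 the $k$-th temporal chunk is $C_k=\{t\in\mathbb{N}:(k-1)\tfrac{T}{K}<t\le k\tfrac{T}{K}\}$, $k=1,\dots,K$. The chunk function $\mathrm{chunk}:\{1,\dots,T\}\to\{1,\dots,K\}$ is defined by $\mathrm{chunk}(t)=k$ iff $t\in C_k$. Local transition matrices. $W^{(k)}$ is the $Q\times Q$ matrix with entries $$W^{(k)}_{lm}=\frac{\#\{t\in C_k: b_t=l,\ b_{t+1}=m,\ t+1\in C_k\}}{\#\{t\in C_k: b_t=l,\ t+1\in C_k\}},\quad l,m\in\{1,\dots,Q\}.$$ All denominators (global and local) are taken to be nonzero, so that every row of these matrices is defined and sums to $1$. Temporal Markov Transition Field. It is the $T\times T$ matrix $\mathcal{M}$ with $\mathcal{M}_{ij}=W^{(\mathrm{chunk}(i))}_{b_i,b_j}$ for $i,j\in\{1,\dots,T\}$. *)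

theory Defs
  imports Complex_Main
begin

text \<open>
  Vectors and matrices are functions on natural-number indices starting at \<open>1\<close>: a time series
  of length \<open>T\<close> is used on \<open>{1..T}\<close> only, a \<open>Q \<times> Q\<close> matrix on \<open>{1..Q}\<close> only.
\<close>

text \<open>
  The \<open>Q\<close> half-open intervals partition the observations. If \<open>Q\<close> does not divide \<open>T\<close>, the
  remaining \<open>T mod Q\<close> observations may be assigned to any of the intervals (this covers all
  conventions for boundary adjustments), hence the inequality in the last clause. If \<open>Q\<close> divides
  \<open>T\<close>, summing over the intervals shows that each contains exactly \<open>T div Q\<close> observations.
\<close>

definition quantile_boundaries :: "nat \<Rightarrow> (nat \<Rightarrow> real) \<Rightarrow> nat \<Rightarrow> (nat \<Rightarrow> real) \<Rightarrow> bool" where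
  "quantile_boundaries T x Q q \<longleftrightarrow>
     (\<forall>k\<in>{1..Q}. q (k - 1) < q k) \<and>
     (\<forall>t\<in>{1..T}. x t \<in> {q 0..<q Q}) \<and>
     (\<forall>k\<in>{1..Q}. card {t\<in>{1..T}. x t \<in> {q (k - 1)..<q k}} \<ge> T div Q)"

definition quantile_state :: "(nat \<Rightarrow> real) \<Rightarrow> nat \<Rightarrow> (nat \<Rightarrow> real) \<Rightarrow> nat \<Rightarrow> nat" where
  "quantile_state x Q q t = (THE k. k \<in> {1..Q} \<and> x t \<in> {q (k - 1)..<q k})"

definition global_count :: "nat \<Rightarrow> (nat \<Rightarrow> nat) \<Rightarrow> nat \<Rightarrow> nat" where
  "global_count T b k = card {t\<in>{1..T - 1}. b t = k}"

definition global_transition :: "nat \<Rightarrow> (nat \<Rightarrow> nat) \<Rightarrow> nat \<Rightarrow> nat \<Rightarrow> real" where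
  "global_transition T b k l =
     real (card {t\<in>{1..T - 1}. b t = k \<and> b (t + 1) = l}) / real (global_count T b k)"

definition markov_transition_field :: "nat \<Rightarrow> (nat \<Rightarrow> nat) \<Rightarrow> nat \<Rightarrow> nat \<Rightarrow> real" where
  "markov_transition_field T b i j = global_transition T b (b i) (b j)"

text \<open>The definition below is meant for \<open>K\<close> dividing \<open>T\<close>, so that \<open>T div K\<close> is the exact quotient.\<close>

definition temporal_chunk :: "nat \<Rightarrow> nat \<Rightarrow> nat \<Rightarrow> nat set" where
  "temporal_chunk T K k = {t. (k - 1) * (T div K) < t \<and> t \<le> k * (T div K)}"

definition chunk :: "nat \<Rightarrow> nat \<Rightarrow> nat \<Rightarrow> nat" where
  "chunk T K t = (THE k. k \<in> {1..K} \<and> t \<in> temporal_chunk T K k)"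

definition local_count :: "nat \<Rightarrow> nat \<Rightarrow> (nat \<Rightarrow> nat) \<Rightarrow> nat \<Rightarrow> nat \<Rightarrow> nat" where
  "local_count T K b k l =
     card {t \<in> temporal_chunk T K k. b t = l \<and> t + 1 \<in> temporal_chunk T K k}"

definition local_transition :: "nat \<Rightarrow> nat \<Rightarrow> (nat \<Rightarrow> nat) \<Rightarrow> nat \<Rightarrow> nat \<Rightarrow> nat \<Rightarrow> real" where
  "local_transition T K b k l m =
     real (card {t \<in> temporal_chunk T K k. b t = l \<and> b (t + 1) = m \<and> t + 1 \<in> temporal_chunk T K k})
       / real (local_count T K b k l)"

definition temporal_markov_transition_field ::
    "nat \<Rightarrow> nat \<Rightarrow> (nat \<Rightarrow> nat) \<Rightarrow> nat \<Rightarrow> nat \<Rightarrow> real" where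
  "temporal_markov_transition_field T K b i j = local_transition T K b (chunk T K i) (b i) (b j)"

end

theory Submission
  imports Defs
begin

text \<open>At (i, j), both fields read the entry (\<open>b i\<close>, \<open>b j\<close>) of a
  transition matrix, one local and one global. These matrices are assumed equal only for chunks in
  \<open>{1..K}\<close> and states in \<open>{1..Q}\<close>, so the content is that the indices lie
  in these ranges. States and chunk numbers are given by \<open>THE\<close>, which is known to
  satisfy its description once a unique candidate exists. \<open>unique_half_open_interval\<close>
  supplies this for any monotone grid; \<open>quantile_state_in_range\<close> applies it to the
  quantile boundaries and \<open>chunk_in_range\<close> to the chunk ends.\<close>

lemma unique_half_open_interval:
  fixes f :: "nat \<Rightarrow> 'a::linorder"
  assumes step: "\<And>k. k \<in> {1..n} \<Longrightarrow> f (k - 1) \<le> f k"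
    and y: "f 0 \<le> y" "y < f n"
  shows "\<exists>!k. k \<in> {1..n} \<and> y \<in> {f (k - 1)..<f k}"
proof (rule ex_ex1I)
  \<comment> \<open>The first grid point above y: minimality will give
    \<open>f (k - 1) \<le> y\<close>, once \<open>f 0 \<le> y\<close> has excluded k = 0.\<close>
  define k where "k = (LEAST k. y < f k)"
  have k: "y < f k" "k \<le> n"
    unfolding k_def using y(2) by (rule LeastI, rule Least_le)
  have "k \<noteq> 0"
    using k(1) y(1) by (metis leD)
  then have "\<not> y < f (k - 1)"
    unfolding k_def by (intro not_less_Least) simp
  with k \<open>k \<noteq> 0\<close> show "\<exists>k. k \<in> {1..n} \<and> y \<in> {f (k - 1)..<f k}"
    by (intro exI[of _ k]) auto
next
  have mono: "f i \<le> f j" if "i \<le> j" "j \<le> n" for i j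
    using that
  proof (induction j rule: dec_induct)
    case (step m)
    then show ?case
      using assms(1)[of "Suc m"] by (auto intro: order_trans)
  qed simp
  have no_less: False
    if "i < j" "j \<in> {1..n}" "y \<in> {f (i - 1)..<f i}" "y \<in> {f (j - 1)..<f j}" for i j
  proof -
    \<comment> \<open>Since \<open>i \<le> j - 1\<close>, this yields y < f i \<le> f (j - 1) \<le>
      y.\<close>
    have "f i \<le> f (j - 1)"
      using that(1,2) by (intro mono) auto
    with that(3,4) show False
      by (meson atLeastLessThan_iff leD order_trans)
  qed
  show "i = j"
    if "i \<in> {1..n} \<and> y \<in> {f (i - 1)..<f i}" "j \<in> {1..n} \<and> y \<in> {f (j - 1)..<f j}" for i j
    using that no_less[of i j] no_less[of j i] by (metis linorder_neqE_nat)
qed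

lemma quantile_state_in_range:
  assumes "quantile_boundaries T x Q q" and "t \<in> {1..T}"
  shows "quantile_state x Q q t \<in> {1..Q}"
proof -
  have "\<exists>!k. k \<in> {1..Q} \<and> x t \<in> {q (k - 1)..<q k}"
    using assms unfolding quantile_boundaries_def
    by (intro unique_half_open_interval) (auto simp: less_imp_le)
  from theI'[OF this] show ?thesis
    unfolding quantile_state_def by blast
qed

lemma chunk_in_range:
  assumes "K dvd T" and "t \<in> {1..T}"
  shows "chunk T K t \<in> {1..K}"
proof -
  \<comment> \<open>Chunks are open on the left and closed on the right; on naturals, shifting both
    ends by one makes them half-open as the lemma requires.\<close>
  define f where "f k = Suc (k * (T div K))" for k
  have chunk_eq: "temporal_chunk T K k = {f (k - 1)..<f k}" for k
    unfolding temporal_chunk_def f_def by auto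
  \<comment> \<open>Divisibility gives \<open>f K = Suc T\<close>, and \<open>f 0 = 1\<close>, so
    the grid spans exactly \<open>{1..T}\<close>.\<close>
  have "\<exists>!k. k \<in> {1..K} \<and> t \<in> {f (k - 1)..<f k}"
    using assms by (intro unique_half_open_interval) (auto simp: f_def)
  from theI'[OF this] show ?thesis
    unfolding chunk_def chunk_eq by blast
qed

theorem proposition4p2:
  fixes T Q K :: nat and x q :: "nat \<Rightarrow> real" and b :: "nat \<Rightarrow> nat"
  assumes "T \<ge> 1" and "Q \<ge> 1" and "K \<ge> 1"
    and "K dvd T"
    and "quantile_boundaries T x Q q"
    and "\<forall>t\<in>{1..T}. b t = quantile_state x Q q t"
    and "\<forall>k\<in>{1..Q}. global_count T b k \<noteq> 0"
    and "\<forall>k\<in>{1..K}. \<forall>l\<in>{1..Q}. local_count T K b k l \<noteq> 0"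
    and "\<forall>k\<in>{1..K}. \<forall>l\<in>{1..Q}. \<forall>m\<in>{1..Q}.
           local_transition T K b k l m = global_transition T b l m"
  shows "\<forall>i\<in>{1..T}. \<forall>j\<in>{1..T}.
           temporal_markov_transition_field T K b i j = markov_transition_field T b i j"
proof (intro ballI)
  fix i j
  assume ij: "i \<in> {1..T}" "j \<in> {1..T}"
  have "b i \<in> {1..Q}" "b j \<in> {1..Q}"
    using ij assms(6) quantile_state_in_range[OF assms(5)] by simp_all
  \<comment> \<open>Only the row index i selects the local matrix; j enters through its state
    alone.\<close>
  moreover have "chunk T K i \<in> {1..K}"
    using assms(4) ij(1) by (rule chunk_in_range)
  ultimately show "temporal_markov_transition_field T K b i j = markov_transition_field T b i j"
    using assms(9) unfolding temporal_markov_transition_field_def markov_transition_field_def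
    by blast
qed

end
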